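(* The elements $d\le2009$ of $\mathcal{D}=\mathcal{D}_+\cup\mathcal{D}_-$ are exactly the following, where $d$ is marked by $(+)$ if $d\in\mathcal{D}_+\setminus(\mathcal{D}_+\cap\mathcal{D}_-)$, by $(-)$ if $d\in\mathcal{D}_-\setminus(\mathcal{D}_+\cap\mathcal{D}_-)$, and by $(\pm)$ if $d\in\mathcal{D}_+\cap\mathcal{D}_-$: $1(\pm)$, $9(-)$, $17(\pm)$, $33(-)$, $41(\pm)$, $57(-)$, $73(\pm)$, $89(\pm)$, $97(\pm)$, $113(\pm)$, $129(-)$, $137(\pm)$, $153(-)$, $161(+)$, $177(-)$, $193(\pm)$, $201(-)$, $209(-)$, $217(+)$, $233(\pm)$, $241(\pm)$, $249(-)$, $281(\pm)$, $297(-)$, $313(\pm)$, $329(+)$, $337(\pm)$, $353(\pm)$, $369(-)$, $393(-)$, $409(\pm)$, $417(-)$, $433(\pm)$, $449(\pm)$, $457(\pm)$, $489(-)$, $497(+)$, $513(-)$, $521(\pm)$, $537(-)$, $553(+)$, $561(-)$, $569(\pm)$, $593(\pm)$, $601(\pm)$, $617(\pm)$, $633(-)$, $641(\pm)$, $649(-)$, $657(-)$, $673(\pm)$, $681(-)$, $713(+)$, $721(+)$, $737(-)$, $753(-)$, $769(\pm)$, $801(-)$, $809(\pm)$, $833(+)$, $849(-)$, $857(\pm)$, $873(-)$, $881(\pm)$, $889(+)$, $913(-)$, $921(-)$, $929(\pm)$, $937(\pm)$, $953(\pm)$, $969(-)$, $977(\pm)$, $1017(-)$, $1033(\pm)$,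 $1041(-)$, $1049(\pm)$, $1057(+)$, $1081(+)$, $1097(\pm)$, $1121(-)$, $1137(-)$, $1153(\pm)$, $1161(-)$, $1169(+)$, $1177(-)$, $1193(\pm)$, $1201(\pm)$, $1217(\pm)$, $1233(-)$, $1241(\pm)$, $1249(\pm)$, $1273(-)$, $1289(\pm)$, $1321(\pm)$, $1329(-)$, $1337(+)$, $1353(-)$, $1361(\pm)$, $1377(-)$, $1401(-)$, $1409(\pm)$, $1433(\pm)$, $1441(-)$, $1457(+)$, $1473(-)$, $1481(\pm)$, $1497(-)$, $1513(+)$, $1529(-)$, $1553(\pm)$, $1561(+)$, $1569(-)$, $1577(-)$, $1609(\pm)$, $1633(+)$, $1649(\pm)$, $1657(\pm)$, $1673(+)$, $1689(-)$, $1697(\pm)$, $1713(-)$, $1721(\pm)$, $1737(-)$, $1753(\pm)$, $1777(\pm)$, $1793(-)$, $1801(\pm)$, $1809(-)$, $1817(+)$, $1841(+)$, $1857(-)$, $1873(\pm)$, $1881(-)$, $1889(\pm)$, $1913(\pm)$, $1921(\pm)$, $1969(-)$, $1977(-)$, $1993(\pm)$, $2009(+)$.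
   Context: $\mathcal{D}_+=\{(a^2-8)/b^2\in\mathbb{N}\mid a,b\in\mathbb{N}\text{ odd}\}$ and $\mathcal{D}_-=\{(a^2+8)/b^2\in\mathbb{N}\mid a,b\in\mathbb{N}\text{ odd}\}$; $\mathbb{N}$ is the set of positive integers. Equivalently, $d\in\mathcal{D}_\pm$ iff $d\in\mathbb{N}$, $d\equiv1\bmod8$ and $a^2-db^2=\pm8$ has an integral solution. *)

theory Defs
  imports Complex_Main
begin

text \<open>
  The quotients are taken in the rationals, so the subtraction is not truncated and the quotient is
  required to be an integer. The set of positive integers is rendered by the type of naturals with
  zero excluded; for \<open>a\<close> and \<open>b\<close> this follows from oddness.
\<close>

definition D_plus :: "nat set" where
  "D_plus = {d. 0 < d \<and> (\<exists>a b :: nat. odd a \<and> odd b \<and>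
     rat_of_nat d = ((rat_of_nat a)\<^sup>2 - 8) / (rat_of_nat b)\<^sup>2)}"

definition D_minus :: "nat set" where
  "D_minus = {d. 0 < d \<and> (\<exists>a b :: nat. odd a \<and> odd b \<and>
     rat_of_nat d = ((rat_of_nat a)\<^sup>2 + 8) / (rat_of_nat b)\<^sup>2)}"

definition D :: "nat set" where
  "D = D_plus \<union> D_minus"

datatype mark = Plus | Minus | PlusMinus

fun has_mark :: "nat \<Rightarrow> mark \<Rightarrow> bool" where
  "has_mark d Plus \<longleftrightarrow> d \<in> D_plus - (D_plus \<inter> D_minus)"
| "has_mark d Minus \<longleftrightarrow> d \<in> D_minus - (D_plus \<inter> D_minus)"
| "has_mark d PlusMinus \<longleftrightarrow> d \<in> D_plus \<inter> D_minus"

end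

theory Submission
  imports Defs
begin

text \<open>
  For \<open>d = 8k + 1\<close>, a solution of \<open>a\<^sup>2 - d b\<^sup>2 = \<plusminus>8\<close> in odd integers with \<open>a \<equiv> b (mod 4)\<close> turns, on
  writing \<open>a = b + 4x\<close>, into a representation of \<open>\<plusminus>1\<close> by the form \<open>2x\<^sup>2 + xb - kb\<^sup>2\<close> of discriminant
  \<open>d\<close>. Representations of 1 by an indefinite form are found by walking along the river of Conway's
  topograph: as long as the outer coefficients have opposite signs, a representation with nonnegative
  arguments either is visible on the river or descends to a smaller one for the next form. The
  river is periodic, so if 1 has not shown up after one period, descent rules it out.
\<close>

section \<open>Binary quadratic forms and the walk along the river\<close>

type_synonym form = "int \<times> int \<times> int"

fun represents :: "form \<Rightarrow> int \<Rightarrow> int \<Rightarrow> bool" where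
  "represents (a, b, c) x y \<longleftrightarrow> a * x\<^sup>2 + b * (x * y) + c * y\<^sup>2 = 1"

fun straddles :: "form \<Rightarrow> bool" where
  "straddles (a, b, c) \<longleftrightarrow> a > 0 \<and> c < 0"

fun mirror :: "form \<Rightarrow> form" where
  "mirror (a, b, c) = (a, - b, c)"

text \<open>
  The first argument bounds the number of steps, the second is the form at which the walk started.
  The river ends at a form representing 0, which happens exactly for square discriminants.
\<close>

fun river :: "nat \<Rightarrow> form \<Rightarrow> form \<Rightarrow> bool option" where
  "river 0 f\<^sub>0 f = None"
| "river (Suc n) f\<^sub>0 (a, b, c) =
    (if a = 1 then Some True
     else let s = a + b + c in
       if s = 0 then Some False
       else let g = (if s < 0 then (a, 2 * a + b, s) else (s, b + 2 * c, c)) in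
         if g = f\<^sub>0 then Some False else river n f\<^sub>0 g)"

text \<open>With \<open>a\<close>, \<open>c\<close> and \<open>a + b + c\<close> the values at (1,
  0), (0, 1) and (1, 1), this is the change to the basis (1, 0), (1, 1). The companion for the other
  step of \<open>river\<close> uses (1, 1), (0, 1).\<close>

lemma represents_shear_left:
  "represents (a, 2 * a + b, a + b + c) x y \<longleftrightarrow> represents (a, b, c) (x + y) y"
  by (simp add: power2_eq_square algebra_simps)

lemma represents_shear_right:
  "represents (a + b + c, b + 2 * c, c) x y \<longleftrightarrow> represents (a, b, c) x (x + y)"
  by (simp add: power2_eq_square algebra_simps)

lemma represents_mirror: "represents (mirror f) x y \<longleftrightarrow> represents f x (- y)"
  by (cases f) simp

text \<open>A leading coefficient 1 is the value at (1, 0), and each step is a change of basis, so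
  this representation is carried back along the walk to \<open>f\<close>.\<close>

lemma river_True_imp_represents:
  assumes "river n f\<^sub>0 f = Some True"
  shows "\<exists>x y. represents f x y"
  using assms
proof (induction n f\<^sub>0 f rule: river.induct)
  case (2 n f\<^sub>0 a b c)
  show ?case
  proof (cases "a = 1")
    case True
    then have "represents (a, b, c) 1 0" by simp
    then show ?thesis by blast
  next
    case False
    define s where "s = a + b + c"
    define g where "g = (if s < 0 then (a, 2 * a + b, s) else (s, b + 2 * c, c))"
    have "s \<noteq> 0" "g \<noteq> f\<^sub>0" "river n f\<^sub>0 g = Some True"
      using "2.prems" False unfolding river.simps Let_def s_def[symmetric] g_def[symmetric]
      by (auto split: if_splits)
    then obtain x y where "represents g x y"
      using "2.IH"[OF False s_def _ g_def] by blast
    then have "represents (a, b, c) (x + y) y \<or> represents (a, b, c) x (x + y)"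
      unfolding g_def s_def
      by (simp only: represents_shear_left represents_shear_right simp_thms split: if_splits)
    then show ?thesis by blast
  qed
qed simp

section \<open>Descent and the decision procedure\<close>

text \<open>The sign of \<open>s\<close> is forced: a wrong sign gives all terms of the sheared form
  the same sign, and the value is then nonpositive or, off the diagonal, at least \<open>a\<close>.
  In particular \<open>s = 0\<close> cannot occur. Both arguments are positive, so subtracting one
  from the other lowers their sum.\<close>

lemma represents_descent:
  fixes a b c :: int and x y :: nat
  defines "s \<equiv> a + b + c"
  assumes "represents (a, b, c) (int x) (int y)" and "a > 1" and "c < 0"
  shows "s < 0 \<and> y \<le> x \<and> 0 < y \<and> represents (a, 2 * a + b, s) (int (x - y)) (int y)
    \<or> s > 0 \<and> x \<le> y \<and> 0 < x \<and> represents (s, b + 2 * c, c) (int x) (int (y - x))"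
proof -
  have "\<not> represents (a, b, c) (int x) 0"
    using assms(3) by (auto simp: zmult_eq_1_iff)
  with assms(2) have y: "0 < y" by (cases y) auto
  have "\<not> represents (a, b, c) 0 (int y)"
    using mult_nonpos_nonneg[of c "(int y)\<^sup>2"] assms(4) by simp
  with assms(2) have x: "0 < x" by (cases x) auto
  show ?thesis
  proof (cases "x < y")
    case True
    define z where "z = int (y - x)"
    have rep: "represents (s, b + 2 * c, c) (int x) z"
      using assms(2) True unfolding s_def represents_shear_right z_def by simp
    have "s > 0"
    proof (rule ccontr)
      assume "\<not> s > 0"
      \<comment> \<open>Here \<open>b + 2 * c = s - a + c\<close>, a sum of nonpositive
        terms.\<close>
      moreover from this have "b + 2 * c \<le> 0" using assms(3,4) unfolding s_def by simp
      ultimately have "s * (int x)\<^sup>2 \<le> 0" "(b + 2 * c) * (int x * z) \<le> 0" "c * z\<^sup>2 \<le> 0"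
        using assms(4) by (auto simp: mult_nonpos_nonneg z_def)
      with rep show False by simp
    qed
    with True x rep show ?thesis unfolding z_def by simp
  next
    case False
    define z where "z = int (x - y)"
    have rep: "represents (a, 2 * a + b, s) z (int y)"
      using assms(2) False unfolding s_def represents_shear_left z_def by simp
    show ?thesis
    proof (cases "s < 0")
      case True
      with False y rep show ?thesis unfolding z_def by simp
    next
      case nonneg: False
      \<comment> \<open>Otherwise \<open>2 * a + b = s + a - c\<close> is positive, and the value is
        at least \<open>a > 1\<close>.\<close>
      have "z = 0"
      proof (rule ccontr)
        assume "z \<noteq> 0"
        then have z: "z \<ge> 1" unfolding z_def by linarith
        have "a * 1 \<le> a * z\<^sup>2" using z assms(3) by (intro mult_left_mono) simp_all
        moreover have "(2 * a + b) * (z * int y) \<ge> 0"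
          using z nonneg assms(3,4) unfolding s_def by (intro mult_nonneg_nonneg) simp_all
        moreover have "s * (int y)\<^sup>2 \<ge> 0" using nonneg by simp
        ultimately show False using rep assms(3) unfolding represents.simps by linarith
      qed
      then have "x = y" and "s * (int y)\<^sup>2 = 1" using False rep unfolding z_def by simp_all
      \<comment> \<open>On the diagonal the second alternative holds: the new leading coefficient is
        1 and the new second argument is 0.\<close>
      then have "s = 1" "(int y)\<^sup>2 = 1" using nonneg by (auto simp: zmult_eq_1_iff)
      with \<open>x = y\<close> y show ?thesis by simp
    qed
  qed
qed

text \<open>The verdict \<open>Some False\<close> arises from \<open>s = 0\<close>, which a
  representation excludes, or from a return to the starting form. Every step before that keeps the
  form straddling and shrinks the arguments.\<close>

lemma river_False_descends:
  fixes x y :: nat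
  assumes "river n f\<^sub>0 f = Some False" and "straddles f" and "represents f (int x) (int y)"
  shows "\<exists>x' y' :: nat. represents f\<^sub>0 (int x') (int y') \<and> x' + y' < x + y"
  using assms
proof (induction n f\<^sub>0 f arbitrary: x y rule: river.induct)
  case (2 n f\<^sub>0 a b c)
  define s where "s = a + b + c"
  define g where "g = (if s < 0 then (a, 2 * a + b, s) else (s, b + 2 * c, c))"
  have a: "a \<noteq> 1" using "2.prems"(1) by auto
  with "2.prems" have "a > 1" "c < 0" by auto
  \<comment> \<open>The descent branches on the sign of \<open>s\<close> just as
    \<open>river\<close> does, so it yields a representation by the next form
    \<open>g\<close>.\<close>
  from represents_descent[OF "2.prems"(3) this]
  obtain x' y' :: nat
    where step: "s \<noteq> 0" "straddles g" "represents g (int x') (int y')" "x' + y' < x + y"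
  proof (elim disjE conjE, fold s_def)
    assume "s < 0" "y \<le> x" "0 < y" "represents (a, 2 * a + b, s) (int (x - y)) (int y)"
    then show thesis using \<open>a > 1\<close> by (intro that[of "x - y" y]) (simp_all add: g_def)
  next
    assume "s > 0" "x \<le> y" "0 < x" "represents (s, b + 2 * c, c) (int x) (int (y - x))"
    then show thesis using \<open>c < 0\<close> by (intro that[of x "y - x"]) (simp_all add: g_def)
  qed
  show ?case
  proof (cases "g = f\<^sub>0")
    case True
    with step show ?thesis by blast
  next
    case False
    then have "river n f\<^sub>0 g = Some False"
      using "2.prems"(1) a step(1)
      unfolding river.simps Let_def s_def[symmetric] g_def[symmetric] by simp
    from "2.IH"[OF a s_def step(1) g_def False this step(2,3)] step(4)
    show ?thesis by (meson less_trans)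
  qed
qed simp

text \<open>One full period turns a representation into a smaller one by the same form: infinite
  descent.\<close>

lemma river_False_imp_not_represents:
  fixes x y :: nat
  assumes "river n f f = Some False" and "straddles f"
  shows "\<not> represents f (int x) (int y)"
proof (induction "x + y" arbitrary: x y rule: less_induct)
  case less
  then show ?case using river_False_descends[OF assms] by metis
qed

text \<open>None of the walks evaluated below takes more than 356 steps.\<close>

definition decide :: "form \<Rightarrow> bool option" where
  "decide f = (case river 400 f f of
     None \<Rightarrow> None
   | Some r \<Rightarrow> if r then Some True else river 400 (mirror f) (mirror f))"

text \<open>Forms are invariant under (x, y) -> (-x, -y), so the four sign patterns of the arguments
  reduce to two. Equal signs are settled by the walk from \<open>f\<close>, opposite signs by the
  walk from \<open>mirror f\<close>.\<close>

lemma decide_correct: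
  assumes "decide f = Some r" and "straddles f"
  shows "r \<longleftrightarrow> (\<exists>x y. represents f x y)"
proof (cases r)
  case True
  with assms(1) have "river 400 f f = Some True \<or> river 400 (mirror f) (mirror f) = Some True"
    by (auto simp: decide_def split: option.splits if_splits)
  then have "\<exists>x y. represents f x y"
    using river_True_imp_represents represents_mirror by blast
  with True show ?thesis by simp
next
  case False
  with assms(1) have "river 400 f f = Some False" "river 400 (mirror f) (mirror f) = Some False"
    by (auto simp: decide_def split: option.splits if_splits)
  moreover have "straddles (mirror f)" using assms(2) by (cases f) simp
  ultimately have no: "\<not> represents f (int x) (int y)" "\<not> represents f (int x) (- int y)" for x y
    using assms(2) river_False_imp_not_represents represents_mirror by blast+
  have "\<not> represents f x y" for x y
  proof -
    have "represents f (- x) (- y) \<longleftrightarrow> represents f x y" for x y by (cases f) simp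
    then show ?thesis
      using no by (cases x rule: int_cases2; cases y rule: int_cases2) (metis minus_minus)+
  qed
  with False show ?thesis by blast
qed

section \<open>From the two sets to representations of 1\<close>

text \<open>Odd \<open>a\<close> and \<open>b\<close> agree modulo 4 up to sign, so
  \<open>a = y + 4 * x\<close> with \<open>y = b\<close> or \<open>y = -b\<close>, and the equation
  divides by 8. Conversely, \<open>y\<close> is odd because an even \<open>y\<close> would make
  \<open>s\<close> even, and absolute values give the natural solution.\<close>

lemma odd_nat_solution_iff:
  fixes k s :: int
  assumes "s = 1 \<or> s = -1"
  shows "(\<exists>a b :: nat. odd a \<and> odd b \<and> (int a)\<^sup>2 - (1 + 8 * k) * (int b)\<^sup>2 = 8 * s) \<longleftrightarrow>
    (\<exists>x y :: int. 2 * x\<^sup>2 + x * y - k * y\<^sup>2 = s)"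
proof
  assume "\<exists>a b :: nat. odd a \<and> odd b \<and> (int a)\<^sup>2 - (1 + 8 * k) * (int b)\<^sup>2 = 8 * s"
  then obtain a b :: nat where ab: "odd a" "odd b" "(int a)\<^sup>2 - (1 + 8 * k) * (int b)\<^sup>2 = 8 * s"
    by blast
  then have "4 dvd int a - int b \<or> 4 dvd int a + int b" by presburger
  then obtain x y where "int a = y + 4 * x" "(int b)\<^sup>2 = y\<^sup>2"
  proof
    assume "4 dvd int a - int b"
    then obtain x where "int a - int b = 4 * x" ..
    then show thesis by (intro that[of "int b" x]) simp_all
  next
    assume "4 dvd int a + int b"
    then obtain x where "int a + int b = 4 * x" ..
    then show thesis by (intro that[of "- int b" x]) simp_all
  qed
  with ab(3) have "(y + 4 * x)\<^sup>2 - (1 + 8 * k) * y\<^sup>2 = 8 * s" by simp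
  then have "2 * x\<^sup>2 + x * y - k * y\<^sup>2 = s"
    by (simp add: power2_eq_square algebra_simps)
  then show "\<exists>x y. 2 * x\<^sup>2 + x * y - k * y\<^sup>2 = s" by blast
next
  assume "\<exists>x y. 2 * x\<^sup>2 + x * y - k * y\<^sup>2 = s"
  then obtain x y where xy: "2 * x\<^sup>2 + x * y - k * y\<^sup>2 = s" by blast
  have "odd y"
  proof
    assume "even y"
    then have "even s" unfolding xy[symmetric] by simp
    with assms show False by auto
  qed
  then have "odd (nat \<bar>y + 4 * x\<bar>)" "odd (nat \<bar>y\<bar>)" by (simp_all add: even_nat_iff)
  moreover have "(int (nat \<bar>y + 4 * x\<bar>))\<^sup>2 - (1 + 8 * k) * (int (nat \<bar>y\<bar>))\<^sup>2 = 8 * s"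
    unfolding xy[symmetric] by (simp add: power2_eq_square algebra_simps)
  ultimately show "\<exists>a b :: nat. odd a \<and> odd b \<and> (int a)\<^sup>2 - (1 + 8 * k) * (int b)\<^sup>2 = 8 * s"
    by blast
qed

text \<open>One statement serves both sets: \<open>t\<close> is -8 for \<open>D_plus\<close> and 8
  for \<open>D_minus\<close>.\<close>

lemma rat_quotient_iff:
  fixes a b d :: nat and t :: int
  assumes "odd b"
  shows "rat_of_nat d = ((rat_of_nat a)\<^sup>2 + of_int t) / (rat_of_nat b)\<^sup>2 \<longleftrightarrow>
    (int a)\<^sup>2 - int d * (int b)\<^sup>2 = - t"
proof -
  have "b \<noteq> 0" using assms by (cases b) auto
  then have "rat_of_nat d = ((rat_of_nat a)\<^sup>2 + of_int t) / (rat_of_nat b)\<^sup>2 \<longleftrightarrow>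
    (of_int (int d * (int b)\<^sup>2) :: rat) = of_int ((int a)\<^sup>2 + t)"
    by (simp add: field_simps)
  also have "\<dots> \<longleftrightarrow> (int a)\<^sup>2 - int d * (int b)\<^sup>2 = - t"
    unfolding of_int_eq_iff by auto
  finally show ?thesis .
qed

lemma D_plus_iff:
  "d \<in> D_plus \<longleftrightarrow> 0 < d \<and>
    (\<exists>a b :: nat. odd a \<and> odd b \<and> (int a)\<^sup>2 - int d * (int b)\<^sup>2 = 8)"
  unfolding D_plus_def using rat_quotient_iff[of _ d _ "-8"] by (simp cong: conj_cong)

lemma D_minus_iff:
  "d \<in> D_minus \<longleftrightarrow> 0 < d \<and>
    (\<exists>a b :: nat. odd a \<and> odd b \<and> (int a)\<^sup>2 - int d * (int b)\<^sup>2 = -8)"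
  unfolding D_minus_def using rat_quotient_iff[of _ d _ 8] by (simp cong: conj_cong)

lemma odd_square_mod_8:
  fixes a :: int
  assumes "odd a"
  shows "a\<^sup>2 mod 8 = 1"
proof -
  obtain m where m: "a = 2 * m + 1" using assms by (rule oddE)
  have "even (m * (m + 1))" by simp
  then obtain t where "m * (m + 1) = 2 * t" ..
  then have "a\<^sup>2 = 8 * t + 1" unfolding m by (simp add: power2_eq_square algebra_simps)
  then show ?thesis by simp
qed

text \<open>Odd squares are 1 modulo 8, so modulo 8 the defining equation reads 1 = d. Only
  \<open>d = 8 * k + 1\<close> remain to be examined.\<close>

lemma D_imp_mod_8:
  assumes "d \<in> D"
  shows "d mod 8 = 1"
proof -
  obtain a b :: nat where "odd a" "odd b" and
    ab: "(int a)\<^sup>2 - int d * (int b)\<^sup>2 = 8 \<or> (int a)\<^sup>2 - int d * (int b)\<^sup>2 = -8"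
    using assms unfolding D_def Un_iff D_plus_iff D_minus_iff by blast
  then have sq: "(int a)\<^sup>2 mod 8 = 1" "(int b)\<^sup>2 mod 8 = 1"
    by (simp_all add: odd_square_mod_8)
  have "(int a)\<^sup>2 mod 8 = (int d * (int b)\<^sup>2) mod 8" using ab by presburger
  also have "\<dots> = int d mod 8" using sq(2) by (metis mod_mult_right_eq mult.right_neutral)
  finally show ?thesis using sq(1) by presburger
qed

lemma D_plus_iff_represents:
  "8 * k + 1 \<in> D_plus \<longleftrightarrow> (\<exists>x y. represents (2, 1, - int k) x y)"
  using odd_nat_solution_iff[of 1 "int k"] by (simp add: D_plus_iff)

text \<open>Negating the form turns the value -1 into 1; exchanging the variables then puts the
  positive coefficient \<open>k\<close> first, as \<open>straddles\<close> demands.\<close>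

lemma D_minus_iff_represents:
  "8 * k + 1 \<in> D_minus \<longleftrightarrow> (\<exists>x y. represents (int k, -1, -2) x y)"
proof -
  have "represents (int k, -1, -2) x y \<longleftrightarrow> 2 * y\<^sup>2 + y * x - int k * x\<^sup>2 = -1" for x y
    by (auto simp: algebra_simps)
  then show ?thesis using odd_nat_solution_iff[of "-1" "int k"] by (auto simp: D_minus_iff)
qed

section \<open>Tabulating the marks\<close>

text \<open>The list has at most one entry; an empty list lets a number outside \<open>D\<close>
  contribute nothing to the table.\<close>

definition marks :: "bool \<Rightarrow> bool \<Rightarrow> mark list" where
  "marks p q = (if p then if q then [PlusMinus] else [Plus] else if q then [Minus] else [])"

lemma set_marks: "set (marks (d \<in> D_plus) (d \<in> D_minus)) = {m. d \<in> D \<and> has_mark d m}"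
proof -
  have "m \<in> set (marks (d \<in> D_plus) (d \<in> D_minus)) \<longleftrightarrow> d \<in> D \<and> has_mark d m" for m
    by (cases m) (auto simp: marks_def D_def)
  then show ?thesis by blast
qed

text \<open>Integer keys keep the evaluation in binary arithmetic. \<open>None\<close> stands for an
  undecided walk, so a result \<open>Some\<close> certifies that both questions were
  settled.\<close>

definition row :: "int \<Rightarrow> (int \<times> mark) list option" where
  "row k = (case decide (2, 1, - k) of None \<Rightarrow> None
     | Some p \<Rightarrow> (case decide (k, -1, -2) of None \<Rightarrow> None
       | Some q \<Rightarrow> Some (map (Pair (8 * k + 1)) (marks p q))))"

fun table :: "int list \<Rightarrow> (int \<times> mark) list option" where
  "table [] = Some []"
| "table (k # ks) = (case row k of None \<Rightarrow> None
     | Some r \<Rightarrow> (case table ks of None \<Rightarrow> None | Some rs \<Rightarrow> Some (r @ rs)))"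

text \<open>Positivity of \<open>k\<close> makes both forms straddle. The second claim keeps rows of
  different \<open>k\<close> from interfering with each other.\<close>

lemma row_correct:
  assumes "row (int k) = Some r" and "0 < k"
  shows "(int (8 * k + 1), m) \<in> set r \<longleftrightarrow> 8 * k + 1 \<in> D \<and> has_mark (8 * k + 1) m"
    and "fst ` set r \<subseteq> {int (8 * k + 1)}"
proof -
  obtain p q where p: "decide (2, 1, - int k) = Some p" and q: "decide (int k, -1, -2) = Some q"
    and r: "r = map (Pair (8 * int k + 1)) (marks p q)"
    using assms(1) by (auto simp: row_def split: option.splits)
  have "p \<longleftrightarrow> 8 * k + 1 \<in> D_plus"
    unfolding D_plus_iff_represents using decide_correct[OF p] \<open>0 < k\<close> by (simp del: represents.simps)
  moreover have "q \<longleftrightarrow> 8 * k + 1 \<in> D_minus"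
    unfolding D_minus_iff_represents using decide_correct[OF q] \<open>0 < k\<close> by (simp del: represents.simps)
  ultimately show "(int (8 * k + 1), m) \<in> set r \<longleftrightarrow> 8 * k + 1 \<in> D \<and> has_mark (8 * k + 1) m"
    using set_marks[of "8 * k + 1"] by (auto simp: r)
  show "fst ` set r \<subseteq> {int (8 * k + 1)}" by (auto simp: r)
qed

lemma table_correct:
  assumes "table (map int ks) = Some rs" and "\<forall>k\<in>set ks. 0 < k"
  shows "(int d, m) \<in> set rs \<longleftrightarrow> d \<in> (\<lambda>k. 8 * k + 1) ` set ks \<and> d \<in> D \<and> has_mark d m"
  using assms
proof (induction ks arbitrary: rs)
  case (Cons k ks)
  from Cons.prems(1) obtain r rs' where r: "row (int k) = Some r"
    and rs': "table (map int ks) = Some rs'" and rs: "rs = r @ rs'"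
    by (auto split: option.splits)
  have "(int d, m) \<in> set r \<longleftrightarrow> d = 8 * k + 1 \<and> d \<in> D \<and> has_mark d m"
  proof (cases "d = 8 * k + 1")
    case True
    then show ?thesis using row_correct(1)[OF r, of m] Cons.prems(2) by simp
  next
    case False
    have "fst ` set r \<subseteq> {int (8 * k + 1)}" using row_correct(2)[OF r] Cons.prems(2) by simp
    then have "int d = int (8 * k + 1)" if "(int d, m) \<in> set r"
      using imageI[OF that, of fst] by auto
    with False show ?thesis by linarith
  qed
  moreover have "(int d, m) \<in> set rs' \<longleftrightarrow> d \<in> (\<lambda>k. 8 * k + 1) ` set ks \<and> d \<in> D \<and> has_mark d m"
    using Cons.IH[OF rs'] Cons.prems(2) by simp
  ultimately show ?case unfolding rs by auto
qed simp

text \<open>The case \<open>d = 1\<close>, i.e. \<open>k = 0\<close>, is missing here, since its forms have no river.\<close>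

definition small_D :: "(nat \<times> mark) list" where
  "small_D =
   [(9, Minus), (17, PlusMinus), (33, Minus), (41, PlusMinus), (57, Minus), (73, PlusMinus),
    (89, PlusMinus), (97, PlusMinus), (113, PlusMinus), (129, Minus), (137, PlusMinus),
    (153, Minus), (161, Plus), (177, Minus), (193, PlusMinus), (201, Minus), (209, Minus),
    (217, Plus), (233, PlusMinus), (241, PlusMinus), (249, Minus), (281, PlusMinus),
    (297, Minus), (313, PlusMinus), (329, Plus), (337, PlusMinus), (353, PlusMinus),
    (369, Minus), (393, Minus), (409, PlusMinus), (417, Minus), (433, PlusMinus),
    (449, PlusMinus), (457, PlusMinus), (489, Minus), (497, Plus), (513, Minus),
    (521, PlusMinus), (537, Minus), (553, Plus), (561, Minus), (569, PlusMinus),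
    (593, PlusMinus), (601, PlusMinus), (617, PlusMinus), (633, Minus), (641, PlusMinus),
    (649, Minus), (657, Minus), (673, PlusMinus), (681, Minus), (713, Plus), (721, Plus),
    (737, Minus), (753, Minus), (769, PlusMinus), (801, Minus), (809, PlusMinus), (833, Plus),
    (849, Minus), (857, PlusMinus), (873, Minus), (881, PlusMinus), (889, Plus), (913, Minus),
    (921, Minus), (929, PlusMinus), (937, PlusMinus), (953, PlusMinus), (969, Minus),
    (977, PlusMinus), (1017, Minus), (1033, PlusMinus), (1041, Minus), (1049, PlusMinus),
    (1057, Plus), (1081, Plus), (1097, PlusMinus), (1121, Minus), (1137, Minus),
    (1153, PlusMinus), (1161, Minus), (1169, Plus), (1177, Minus), (1193, PlusMinus),
    (1201, PlusMinus), (1217, PlusMinus), (1233, Minus), (1241, PlusMinus), (1249, PlusMinus),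
    (1273, Minus), (1289, PlusMinus), (1321, PlusMinus), (1329, Minus), (1337, Plus),
    (1353, Minus), (1361, PlusMinus), (1377, Minus), (1401, Minus), (1409, PlusMinus),
    (1433, PlusMinus), (1441, Minus), (1457, Plus), (1473, Minus), (1481, PlusMinus),
    (1497, Minus), (1513, Plus), (1529, Minus), (1553, PlusMinus), (1561, Plus), (1569, Minus),
    (1577, Minus), (1609, PlusMinus), (1633, Plus), (1649, PlusMinus), (1657, PlusMinus),
    (1673, Plus), (1689, Minus), (1697, PlusMinus), (1713, Minus), (1721, PlusMinus),
    (1737, Minus), (1753, PlusMinus), (1777, PlusMinus), (1793, Minus), (1801, PlusMinus),
    (1809, Minus), (1817, Plus), (1841, Plus), (1857, Minus), (1873, PlusMinus), (1881, Minus),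
    (1889, PlusMinus), (1913, PlusMinus), (1921, PlusMinus), (1969, Minus), (1977, Minus),
    (1993, PlusMinus), (2009, Plus)]"

text \<open>This is the whole computation; the last index 251 belongs to \<open>d = 2009\<close>.
  The right-hand side is first turned into explicit integer pairs, then the walks are
  evaluated.\<close>

lemma table_value: "table [1..251] = Some (map (map_prod int id) small_D)"
  unfolding small_D_def
  by (simp only: list.map map_prod_simp id_apply of_nat_numeral, code_simp)

lemma has_mark_1_iff: "1 \<in> D \<and> has_mark 1 m \<longleftrightarrow> m = PlusMinus"
proof -
  have "(1::nat) \<in> D_plus" unfolding D_plus_iff
    \<comment> \<open>The witnesses are 3^2 - 1 * 1^2 = 8 here and 1^2 - 1 * 3^2 = -8 below.\<close>
    by (rule conjI, simp, rule exI[of _ 3], rule exI[of _ 1], simp)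
  moreover have "(1::nat) \<in> D_minus" unfolding D_minus_iff
    by (rule conjI, simp, rule exI[of _ 1], rule exI[of _ 3], simp)
  ultimately have "set (marks (1 \<in> D_plus) (1 \<in> D_minus)) = {PlusMinus}" by (simp add: marks_def)
  then show ?thesis unfolding set_marks by blast
qed

theorem theorem3p2p5:
  shows "{(d, m). d \<in> D \<and> d \<le> 2009 \<and> has_mark d m} =
    {(1, PlusMinus), (9, Minus), (17, PlusMinus), (33, Minus), (41, PlusMinus),
     (57, Minus), (73, PlusMinus), (89, PlusMinus), (97, PlusMinus), (113, PlusMinus),
     (129, Minus), (137, PlusMinus), (153, Minus), (161, Plus), (177, Minus),
     (193, PlusMinus), (201, Minus), (209, Minus), (217, Plus), (233, PlusMinus),
     (241, PlusMinus), (249, Minus), (281, PlusMinus), (297, Minus), (313, PlusMinus),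
     (329, Plus), (337, PlusMinus), (353, PlusMinus), (369, Minus), (393, Minus),
     (409, PlusMinus), (417, Minus), (433, PlusMinus), (449, PlusMinus), (457, PlusMinus),
     (489, Minus), (497, Plus), (513, Minus), (521, PlusMinus), (537, Minus),
     (553, Plus), (561, Minus), (569, PlusMinus), (593, PlusMinus), (601, PlusMinus),
     (617, PlusMinus), (633, Minus), (641, PlusMinus), (649, Minus), (657, Minus),
     (673, PlusMinus), (681, Minus), (713, Plus), (721, Plus), (737, Minus),
     (753, Minus), (769, PlusMinus), (801, Minus), (809, PlusMinus), (833, Plus),
     (849, Minus), (857, PlusMinus), (873, Minus), (881, PlusMinus), (889, Plus),
     (913, Minus), (921, Minus), (929, PlusMinus), (937, PlusMinus), (953, PlusMinus),
     (969, Minus), (977, PlusMinus), (1017, Minus), (1033, PlusMinus), (1041, Minus),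
     (1049, PlusMinus), (1057, Plus), (1081, Plus), (1097, PlusMinus), (1121, Minus),
     (1137, Minus), (1153, PlusMinus), (1161, Minus), (1169, Plus), (1177, Minus),
     (1193, PlusMinus), (1201, PlusMinus), (1217, PlusMinus), (1233, Minus), (1241, PlusMinus),
     (1249, PlusMinus), (1273, Minus), (1289, PlusMinus), (1321, PlusMinus), (1329, Minus),
     (1337, Plus), (1353, Minus), (1361, PlusMinus), (1377, Minus), (1401, Minus),
     (1409, PlusMinus), (1433, PlusMinus), (1441, Minus), (1457, Plus), (1473, Minus),
     (1481, PlusMinus), (1497, Minus), (1513, Plus), (1529, Minus), (1553, PlusMinus),
     (1561, Plus), (1569, Minus), (1577, Minus), (1609, PlusMinus), (1633, Plus),
     (1649, PlusMinus), (1657, PlusMinus), (1673, Plus), (1689, Minus), (1697, PlusMinus),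
     (1713, Minus), (1721, PlusMinus), (1737, Minus), (1753, PlusMinus), (1777, PlusMinus),
     (1793, Minus), (1801, PlusMinus), (1809, Minus), (1817, Plus), (1841, Plus),
     (1857, Minus), (1873, PlusMinus), (1881, Minus), (1889, PlusMinus), (1913, PlusMinus),
     (1921, PlusMinus), (1969, Minus), (1977, Minus), (1993, PlusMinus), (2009, Plus)}"
proof -
  \<comment> \<open>The evaluated table runs over integers, while its correctness is stated for
    images of naturals.\<close>
  have upto: "[1..251] = map int [1..<252]" by code_simp
  have small: "(d, m) \<in> set small_D \<longleftrightarrow>
    d \<in> (\<lambda>k. 8 * k + 1) ` {1..<252} \<and> d \<in> D \<and> has_mark d m" for d m
  proof -
    have "(d, m) \<in> set small_D \<longleftrightarrow> (int d, m) \<in> set (map (map_prod int id) small_D)"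
      by force
    also have "\<dots> \<longleftrightarrow> d \<in> (\<lambda>k. 8 * k + 1) ` set [1..<252] \<and> d \<in> D \<and> has_mark d m"
      by (rule table_correct[OF table_value[unfolded upto]]) simp
    finally show ?thesis by simp
  qed
  \<comment> \<open>The index is \<open>d div 8\<close>: the remainder is 1, the bound 2009 gives at
    most 251, and quotient 0 leaves only \<open>d = 1\<close>.\<close>
  have cover: "d = 1 \<or> d \<in> (\<lambda>k. 8 * k + 1) ` {1..<252}" if "d \<in> D" "d \<le> 2009" for d
  proof (cases "d div 8 = 0")
    case True
    then have "d = 1" using D_imp_mod_8[OF that(1)] by presburger
    then show ?thesis ..
  next
    case False
    have "d = 8 * (d div 8) + 1" using D_imp_mod_8[OF that(1)] by presburger
    moreover have "d div 8 \<in> {1..<252}" using False that(2) by auto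
    ultimately show ?thesis by (intro disjI2 image_eqI)
  qed
  have "d \<in> D \<and> d \<le> 2009 \<and> has_mark d m \<longleftrightarrow> (d, m) = (1, PlusMinus) \<or> (d, m) \<in> set small_D"
    for d m
  proof (cases "d = 1")
    case True
    then show ?thesis using has_mark_1_iff unfolding small by auto
  next
    case False
    have "d \<le> 2009" if "d \<in> (\<lambda>k. 8 * k + 1) ` {1..<252}" using that by auto
    with False show ?thesis using cover unfolding small by blast
  qed
  then have "{(d, m). d \<in> D \<and> d \<le> 2009 \<and> has_mark d m} = insert (1, PlusMinus) (set small_D)"
    by auto
  then show ?thesis unfolding small_D_def list.set .
qed

end
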